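(* Consider the non-strongly convex quadratic optimization problem $\min_{x\in\mathbb{R}^d} f(x)$, $f(x)=\frac1n\sum_{i=1}^n f_i(x)$, where $f_i(x)=\frac12 x^\top A_i x-b_i^\top x$ for all $i\in\{1,\dots,n\}$, with $A_i\in\mathbb{R}^{d\times d}$ symmetric positive semidefinite and $b_i\in\mathbb{R}^d$, and assume that there exists $x_*\in\mathbb{R}^d$ with $\nabla f_i(x_* )=0$ for all $i$ (interpolation). Let $$T_\eta(\gamma):=\widetilde{\mathcal{O}}\left(\big(\eta+\tau(\gamma L_{\max}+1)\big)\times\frac{L_\gamma}{\mu_\gamma^+}\right)$$ be the total time complexity of FedExProx, and let $$T_{\mathrm{GD}}:=T_\eta(0)=\widetilde{\mathcal{O}}\left((\eta+\tau)\times\frac{L}{\mu^+}\right)$$ be that of gradient descent. Up to a constant factor, the time complexity $T_\eta(\gamma)$ is minimized by some $$\gamma\in\left[\frac{1}{\max_{i}\lambda_{\max}(A_i)},\ \min\left\{\frac{\frac{\eta}{\tau}-1}{\max_{i}\lambda_{\max}(A_i)},\ \frac{1}{\min_{i}\lambda_{\min}^+(A_i)}\right\}\right]$$ if $\frac{\eta}{\tau}\ge2$, and by some $$\gamma\in\left[0,\ \max\left\{0,\ \min\left\{\frac{\frac{\eta}{\tau}-1}{\max_{i}\lambda_{\max}(A_i)},\ \frac{1}{\min_{i}\lambda_{\min}^+(A_i)}\right\}\right\}\right]$$ if $\frac{\eta}{\tau}<2$. Moreover, $T_\eta(\gamma)\le T_{\mathrm{GD}}$.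
   Context: Maxima and minima over $i$ are over $i\in\{1,\dots,n\}$. $\lambda_{\max}(B)$ and $\lambda_{\min}^+(B)$ denote the largest and the smallest non-zero eigenvalue of $B$. For a convex function $g$ and $\gamma>0$, $\mathrm{prox}_{\gamma g}(x)=\arg\min_z\{g(z)+\frac1{2\gamma}\|z-x\|^2\}$ and $M_g^\gamma(x)=\min_z\{g(z)+\frac1{2\gamma}\|z-x\|^2\}$ (Moreau envelope). $M^\gamma=\frac1n\sum_{i=1}^nM^\gamma_{f_i}$ is here a quadratic with Hessian $\nabla^2M^\gamma=\frac1n\sum_{i=1}^n\frac1\gamma\big(I-(\gamma A_i+I)^{-1}\big)$; $L_\gamma$ is the smoothness constant of $M^\gamma$ (largest eigenvalue of this Hessian) and $\mu_\gamma^+$ its smallest non-zero eigenvalue. $L$ and $\mu^+$ are the largest and smallest non-zero eigenvalues of $\frac1n\sum_iA_i$, and $L_{\max}=\max_i\lambda_{\max}(A_i)$. FedExProx iterates $x_{k+1}=x_k+\alpha\big(\frac1n\sum_i\mathrm{prox}_{\gamma f_i}(x_k)-x_k\big)$ with $\alpha=\frac1{\gamma L_\gamma}$ and needs $\mathcal{O}\big(\frac{L_\gamma}{\mu_\gamma^+}\log\frac1\varepsilon\big)$ iterations to reach accuracy $\varepsilon$. One local gradient computation takes $\tau$ seconds and computing all proximal operators by gradient descent takes $\widetilde{\mathcal{O}}(\tau(\gamma L_{\max}+1))$ seconds; communication takes $\eta$ seconds per iteration. So the time per iteration is proportional to $\eta+\tau(\gamma L_{\max}+1)$. $\widetilde{\mathcal{O}}$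 hides constants and logarithmic factors. *)

theory Defs
  imports "HOL-Analysis.Analysis"
begin

definition eigvals :: "real^'d^'d \<Rightarrow> real set" where
  "eigvals B = {l. \<exists>v. v \<noteq> 0 \<and> B *v v = l *\<^sub>R v}"

definition lambda_max :: "real^'d^'d \<Rightarrow> real" where
  "lambda_max B = Max (eigvals B)"

text \<open>Only meaningful for a matrix with a non-zero eigenvalue.\<close>

definition lambda_min_pos :: "real^'d^'d \<Rightarrow> real" where
  "lambda_min_pos B = Min (eigvals B - {0})"

definition sym_psd :: "real^'d^'d \<Rightarrow> bool" where
  "sym_psd B \<longleftrightarrow> transpose B = B \<and> (\<forall>x. 0 \<le> x \<bullet> (B *v x))"

definition gradient :: "(real^'d \<Rightarrow> real) \<Rightarrow> real^'d \<Rightarrow> real^'d" where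
  "gradient g x = (THE D. GDERIV g x :> D)"

definition hessian :: "(real^'d \<Rightarrow> real) \<Rightarrow> real^'d \<Rightarrow> real^'d^'d" where
  "hessian g x = jacobian (gradient g) (at x)"

definition quad :: "real^'d^'d \<Rightarrow> real^'d \<Rightarrow> real^'d \<Rightarrow> real" where
  "quad B c x = 1 / 2 * (x \<bullet> (B *v x)) - c \<bullet> x"

text \<open>For \<open>\<gamma> > 0\<close> and convex continuous \<open>g\<close> the infimum is attained.\<close>

definition moreau :: "real \<Rightarrow> (real^'d \<Rightarrow> real) \<Rightarrow> real^'d \<Rightarrow> real" where
  "moreau \<gamma> g x = (INF z. g z + 1 / (2 * \<gamma>) * (norm (z - x))\<^sup>2)"

definition avg_moreau ::
  "nat \<Rightarrow> (nat \<Rightarrow> real^'d^'d) \<Rightarrow> (nat \<Rightarrow> real^'d) \<Rightarrow> real \<Rightarrow> real^'d \<Rightarrow> real" where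
  "avg_moreau n A b \<gamma> x = 1 / real n * (\<Sum>i=1..n. moreau \<gamma> (quad (A i) (b i)) x)"

definition avg_matrix :: "nat \<Rightarrow> (nat \<Rightarrow> real^'d^'d) \<Rightarrow> real^'d^'d" where
  "avg_matrix n A = (1 / real n) *\<^sub>R (\<Sum>i=1..n. A i)"

text \<open>For \<open>\<gamma> > 0\<close> the averaged envelope is quadratic, so its Hessian is the same at every point
  and is taken at the origin. The value at \<open>\<gamma> = 0\<close> is the limit as \<open>\<gamma>\<close> tends to \<open>0\<close>: the Hessian
  of the objective itself, so that \<open>\<gamma> = 0\<close> stands for gradient descent.\<close>

definition env_hessian ::
  "nat \<Rightarrow> (nat \<Rightarrow> real^'d^'d) \<Rightarrow> (nat \<Rightarrow> real^'d) \<Rightarrow> real \<Rightarrow> real^'d^'d" where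
  "env_hessian n A b \<gamma> = (if \<gamma> = 0 then avg_matrix n A else hessian (avg_moreau n A b \<gamma>) 0)"

definition L_max :: "nat \<Rightarrow> (nat \<Rightarrow> real^'d^'d) \<Rightarrow> real" where
  "L_max n A = Max ((\<lambda>i. lambda_max (A i)) ` {1..n})"

text \<open>A zero matrix has no non-zero eigenvalue and does not contribute to the minimum.\<close>

definition lambda_min_pos_all :: "nat \<Rightarrow> (nat \<Rightarrow> real^'d^'d) \<Rightarrow> real" where
  "lambda_min_pos_all n A = Min ((\<lambda>i. lambda_min_pos (A i)) ` {i \<in> {1..n}. A i \<noteq> 0})"

text \<open>Time per iteration times \<open>L\<^sub>\<gamma> / \<mu>\<^sub>\<gamma>\<^sup>+\<close>, without the constants and logarithmic factors that
  the asymptotic notation hides. Here \<open>\<eta>\<close> is the time of one communication and \<open>\<tau>\<close> that of one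
  local gradient computation.\<close>

definition total_time ::
  "nat \<Rightarrow> (nat \<Rightarrow> real^'d^'d) \<Rightarrow> (nat \<Rightarrow> real^'d) \<Rightarrow> real \<Rightarrow> real \<Rightarrow> real \<Rightarrow> real" where
  "total_time n A b \<eta> \<tau> \<gamma> =
     (\<eta> + \<tau> * (\<gamma> * L_max n A + 1)) *
     (lambda_max (env_hessian n A b \<gamma>) / lambda_min_pos (env_hessian n A b \<gamma>))"

definition gd_time :: "nat \<Rightarrow> (nat \<Rightarrow> real^'d^'d) \<Rightarrow> real \<Rightarrow> real \<Rightarrow> real" where
  "gd_time n A \<eta> \<tau> =
     (\<eta> + \<tau>) * (lambda_max (avg_matrix n A) / lambda_min_pos (avg_matrix n A))"

lemma total_time_zero: "total_time n A b \<eta> \<tau> 0 = gd_time n A \<eta> \<tau>"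
  by (simp add: total_time_def gd_time_def env_hessian_def)

text \<open>\<open>\<gamma>\<close> minimizes \<open>T\<close> over the non-negative stepsizes up to the factor \<open>C\<close>.\<close>

definition minimizes_up_to :: "real \<Rightarrow> (real \<Rightarrow> real) \<Rightarrow> real \<Rightarrow> bool" where
  "minimizes_up_to C T \<gamma> \<longleftrightarrow> 0 \<le> \<gamma> \<and> (\<forall>\<gamma>'\<ge>0. T \<gamma> \<le> C * T \<gamma>')"

end

theory Submission
  imports Defs
begin

text \<open>The Hessian of the averaged envelope is \<open>H(\<gamma>) = 1/n \<Sum> A\<^sub>i (I + \<gamma> A\<^sub>i)\<^sup>-\<^sup>1\<close>. Diagonalising each
  \<open>A\<^sub>i\<close>, whose non-zero eigenvalues lie in \<open>[m, L]\<close>, gives for \<open>\<gamma> \<le> \<gamma>'\<close> the Loewner bounds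
  \<open>r(L) H(\<gamma>) \<le> H(\<gamma>') \<le> r(m) H(\<gamma>)\<close> with \<open>r(\<lambda>) = (1 + \<gamma> \<lambda>) / (1 + \<gamma>' \<lambda>)\<close>. In particular all \<open>H(\<gamma>)\<close>
  have the same kernel, and the condition numbers at \<open>\<gamma>\<close> and \<open>\<gamma>'\<close> differ at most by the factor
  \<open>r(m) / r(L)\<close>. Weighing this factor against the time per iteration shows that nothing outside the
  stated interval beats its endpoints by more than a constant. For \<open>\<eta> / \<tau> < 2\<close> the stepsize \<open>0\<close>
  suffices.\<close>

subsection \<open>Spectral theorem and condition numbers\<close>

text \<open>A maximizer \<open>e\<close> of the Rayleigh quotient on the compact unit sphere of
  \<open>S\<close> is an eigenvector: the residual \<open>r = f e - l e\<close> is orthogonal to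
  \<open>e\<close>, stays in \<open>S\<close> by invariance, and would be a direction of first-order
  increase unless it vanished.\<close>

lemma selfadjoint_eigenvector:
  fixes f :: "'a::euclidean_space \<Rightarrow> 'a"
  assumes lin: "linear f" and sym: "\<And>x y. f x \<bullet> y = x \<bullet> f y"
    and S: "subspace S" "f ` S \<subseteq> S" "S \<noteq> {0}"
  obtains e l where "e \<in> S" "norm e = 1" "f e = l *\<^sub>R e"
proof -
  have cont: "continuous_on (S \<inter> sphere 0 1) (\<lambda>x. x \<bullet> f x)"
    by (intro continuous_intros linear_continuous_on lin linear_conv_bounded_linear[THEN iffD1])
  have comp: "compact (S \<inter> sphere 0 1)"
    by (intro closed_Int_compact closed_subspace S compact_sphere)
  obtain x0 where x0: "x0 \<in> S" "x0 \<noteq> 0"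
    using S subspace_0 by blast
  have "x0 /\<^sub>R norm x0 \<in> S \<inter> sphere 0 1"
    using x0 S by (simp add: subspace_scale)
  then have "S \<inter> sphere 0 1 \<noteq> {}" by blast
  then obtain e where "e \<in> S \<inter> sphere 0 1" "\<forall>y\<in>S \<inter> sphere 0 1. y \<bullet> f y \<le> e \<bullet> f e"
    using continuous_attains_sup[OF comp _ cont] by blast
  then have e: "e \<in> S" "norm e = 1"
    and max: "\<And>y. y \<in> S \<Longrightarrow> norm y = 1 \<Longrightarrow> y \<bullet> f y \<le> e \<bullet> f e"
    by auto
  define l where "l = e \<bullet> f e"
  have le: "y \<bullet> f y \<le> l * (norm y)\<^sup>2" if "y \<in> S" for y
  proof (cases "y = 0")
    case False
    have "(y /\<^sub>R norm y) \<bullet> f (y /\<^sub>R norm y) \<le> l"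
      unfolding l_def using False that S by (intro max) (auto simp: subspace_scale)
    then show ?thesis
      using False by (simp add: linear_cmul[OF lin] field_simps power2_eq_square)
  qed (simp add: linear_0[OF lin])
  define r where "r = f e - l *\<^sub>R e"
  define a where "a = (norm r)\<^sup>2"
  define c where "c = l * a - r \<bullet> f r"
  have rS: "r \<in> S"
    unfolding r_def using S e by (auto intro!: subspace_diff subspace_scale)
  have ee: "e \<bullet> e = 1"
    using e by (simp add: norm_eq_1)
  have re: "r \<bullet> e = 0"
    by (simp add: r_def inner_diff_left ee) (simp add: l_def inner_commute)
  have rfe: "r \<bullet> f e = a"
  proof -
    have "r \<bullet> f e = r \<bullet> (r + l *\<^sub>R e)" by (simp add: r_def)
    also have "\<dots> = a" by (simp add: inner_add_right re a_def power2_norm_eq_inner)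
    finally show ?thesis .
  qed
  have erf: "e \<bullet> f r = a"
    using rfe sym[of e r] by (simp add: inner_commute)
  have er: "e \<bullet> r = 0"
    using re by (simp add: inner_commute)
  text \<open>Maximality of \<open>e\<close>, tested along \<open>e + t r\<close>; for small \<open>t > 0\<close> it forces \<open>a = 0\<close>.\<close>
  have quad: "2 * t * a \<le> t\<^sup>2 * c" for t
  proof -
    have "e + t *\<^sub>R r \<in> S"
      using S e rS by (simp add: subspace_add subspace_scale)
    note le[OF this]
    also have "(norm (e + t *\<^sub>R r))\<^sup>2 = 1 + t\<^sup>2 * a"
      unfolding power2_norm_eq_inner a_def
      by (simp add: inner_add_left inner_add_right re er ee power2_eq_square)
    also have "(e + t *\<^sub>R r) \<bullet> f (e + t *\<^sub>R r) = l + 2 * t * a + t\<^sup>2 * (r \<bullet> f r)"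
      by (simp add: linear_add[OF lin] linear_cmul[OF lin] inner_add_left inner_add_right
          rfe erf l_def power2_eq_square algebra_simps)
    finally show ?thesis
      by (simp add: c_def algebra_simps)
  qed
  have a0: "0 \<le> a" by (simp add: a_def)
  have c0: "0 \<le> c" using quad[of 1] a0 by simp
  have "a = 0"
  proof (rule ccontr)
    assume "a \<noteq> 0"
    \<comment> \<open>This choice makes \<open>t * c\<close> less than \<open>a\<close>, against
      \<open>2 * a \<le> t * c\<close>. Adding 1 keeps the denominator positive when
      \<open>c = 0\<close>.\<close>
    define t where "t = a / (c + 1)"
    have t: "0 < t" "t * (c + 1) = a"
      using \<open>a \<noteq> 0\<close> a0 c0 by (auto simp: t_def)
    have "t * (2 * a) \<le> t * (t * c)"
      using quad[of t] by (simp add: power2_eq_square algebra_simps)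
    with t(1) have "2 * a \<le> t * c" by simp
    moreover have "t * c + t = a"
      using t(2) by (simp add: algebra_simps)
    ultimately show False
      using t(1) a0 by linarith
  qed
  then have "f e = l *\<^sub>R e" by (simp add: a_def r_def)
  with e show thesis using that by blast
qed

text \<open>Induction on the dimension: after a unit eigenvector is split off, its orthogonal
  complement in \<open>S\<close> is again invariant, by self-adjointness, and strictly
  smaller.\<close>

lemma selfadjoint_orthonormal_eigenbasis:
  fixes f :: "'a::euclidean_space \<Rightarrow> 'a"
  assumes lin: "linear f" and sym: "\<And>x y. f x \<bullet> y = x \<bullet> f y"
    and "subspace S" "f ` S \<subseteq> S"
  shows "\<exists>E. pairwise orthogonal E \<and> (\<forall>e\<in>E. norm e = 1 \<and> (\<exists>l. f e = l *\<^sub>R e)) \<and> span E = S"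
  using assms(3,4)
proof (induction "dim S" arbitrary: S rule: less_induct)
  case less
  show ?case
  proof (cases "S = {0}")
    case True
    then show ?thesis by (intro exI[of _ "{}"]) auto
  next
    case False
    obtain e l where e: "e \<in> S" "norm e = 1" "f e = l *\<^sub>R e"
      using selfadjoint_eigenvector[OF lin sym less.prems False] by blast
    define T where "T = {x \<in> S. e \<bullet> x = 0}"
    have ee: "e \<bullet> e = 1" using e by (simp add: norm_eq_1)
    have T: "subspace T"
      using less.prems(1) by (auto simp: T_def subspace_def inner_add_right)
    have "e \<bullet> f x = 0" if "x \<in> T" for x
      using that sym[of e x] by (simp add: T_def e(3))
    then have fT: "f ` T \<subseteq> T"
      using less.prems(2) by (auto simp: T_def)
    have "T \<subseteq> S" "e \<notin> T" by (auto simp: T_def ee)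
    then have "span T \<subset> span S"
      using e T less.prems(1) by (auto simp: span_eq_iff[THEN iffD2])
    then have "dim T < dim S" by (rule dim_psubset)
    from less.hyps[OF this T fT] obtain E where
      E: "pairwise orthogonal E" "\<forall>e\<in>E. norm e = 1 \<and> (\<exists>l. f e = l *\<^sub>R e)" "span E = T"
      by blast
    have ET: "E \<subseteq> T" using E(3) span_superset by blast
    have "pairwise orthogonal (insert e E)"
      using E(1) ET by (auto simp: pairwise_insert orthogonal_def T_def inner_commute)
    moreover have "span (insert e E) = S"
    proof
      show "span (insert e E) \<subseteq> S"
        using ET \<open>T \<subseteq> S\<close> e less.prems(1) by (intro span_minimal) auto
      show "S \<subseteq> span (insert e E)"
      proof
        fix x assume x: "x \<in> S"
        have "x - (e \<bullet> x) *\<^sub>R e \<in> T"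
          using x e less.prems(1)
          by (auto simp: T_def inner_diff_right ee intro!: subspace_diff subspace_scale)
        then show "x \<in> span (insert e E)"
          using E(3) by (auto simp: span_insert)
      qed
    qed
    ultimately show ?thesis
      using E(2) e by (intro exI[of _ "insert e E"]) auto
  qed
qed

text \<open>Orthonormality is encoded by the expansion identity: unit vectors that satisfy it are
  pairwise orthogonal, by Parseval. Indexing \<open>l\<close> by basis vectors records eigenvalues
  with multiplicity.\<close>

definition eigenbasis :: "real^'d^'d \<Rightarrow> (real^'d) set \<Rightarrow> (real^'d \<Rightarrow> real) \<Rightarrow> bool" where
  "eigenbasis B E l \<longleftrightarrow> finite E \<and> (\<forall>x. (\<Sum>e\<in>E. (x \<bullet> e) *\<^sub>R e) = x) \<and>
     (\<forall>e\<in>E. norm e = 1 \<and> B *v e = l e *\<^sub>R e)"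

lemma symmetric_inner:
  fixes B :: "real^'d^'d"
  assumes "transpose B = B"
  shows "(B *v x) \<bullet> y = x \<bullet> (B *v y)"
  by (metis assms dot_lmul_matrix vector_transpose_matrix)

lemma eigenbasis_exists:
  fixes B :: "real^'d^'d"
  assumes "transpose B = B"
  obtains E l where "eigenbasis B E l"
proof -
  obtain E where E: "pairwise orthogonal E"
      "\<forall>e\<in>E. norm e = 1 \<and> (\<exists>l. B *v e = l *\<^sub>R e)" "span E = UNIV"
    using selfadjoint_orthonormal_eigenbasis[OF matrix_vector_mul_linear[of B]
        symmetric_inner[OF assms] subspace_UNIV] by auto
  have fin: "finite E"
    by (rule pairwise_orthogonal_imp_finite[OF E(1)])
  obtain l where "\<forall>e\<in>E. B *v e = l e *\<^sub>R e"
    using E(2) by metis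
  then have "eigenbasis B E l"
    unfolding eigenbasis_def
    using fin E orthonormal_basis_expand[OF E(1) _ _ fin] by auto
  then show thesis using that by blast
qed

lemma eigenbasis_inner:
  assumes "eigenbasis B E l"
  shows "x \<bullet> y = (\<Sum>e\<in>E. (x \<bullet> e) * (y \<bullet> e))"
proof -
  have "x \<bullet> y = x \<bullet> (\<Sum>e\<in>E. (y \<bullet> e) *\<^sub>R e)"
    using assms by (simp add: eigenbasis_def)
  then show ?thesis
    by (simp add: inner_sum_right mult.commute)
qed

lemma eigenbasis_mult:
  fixes B :: "real^'d^'d"
  assumes "eigenbasis B E l"
  shows "B *v x = (\<Sum>e\<in>E. (l e * (x \<bullet> e)) *\<^sub>R e)"
proof -
  have "B *v x = B *v (\<Sum>e\<in>E. (x \<bullet> e) *\<^sub>R e)"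
    using assms by (simp add: eigenbasis_def)
  also have "\<dots> = (\<Sum>e\<in>E. (x \<bullet> e) *\<^sub>R (B *v e))"
    by (simp add: linear_sum[OF matrix_vector_mul_linear] matrix_vector_mult_scaleR)
  also have "\<dots> = (\<Sum>e\<in>E. (l e * (x \<bullet> e)) *\<^sub>R e)"
    using assms by (intro sum.cong) (auto simp: eigenbasis_def)
  finally show ?thesis .
qed

lemma eigenbasis_form:
  assumes "eigenbasis B E l"
  shows "y \<bullet> (B *v x) = (\<Sum>e\<in>E. l e * ((x \<bullet> e) * (y \<bullet> e)))"
  by (simp add: eigenbasis_mult[OF assms] inner_sum_right mult.assoc)

lemma eigenbasis_nonneg:
  assumes "sym_psd B" "eigenbasis B E l" "e \<in> E"
  shows "0 \<le> l e"
proof -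
  have "norm e = 1" "B *v e = l e *\<^sub>R e"
    using assms by (auto simp: eigenbasis_def)
  moreover have "0 \<le> e \<bullet> (B *v e)"
    using assms(1) by (simp add: sym_psd_def)
  ultimately show ?thesis by (simp add: norm_eq_1)
qed

text \<open>A non-zero eigenvector \<open>v\<close> has a non-zero coefficient at some
  \<open>e\<close>; evaluating \<open>B\<close> between \<open>v\<close> and \<open>e\<close> from
  both sides identifies the two eigenvalues.\<close>

lemma eigvals_eigenbasis:
  assumes "transpose B = B" "eigenbasis B E l"
  shows "eigvals B = l ` E"
proof (intro equalityI subsetI)
  fix \<mu> assume "\<mu> \<in> eigvals B"
  then obtain v where v: "v \<noteq> 0" "B *v v = \<mu> *\<^sub>R v"
    by (auto simp: eigvals_def)
  have "\<exists>e\<in>E. v \<bullet> e \<noteq> 0"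
  proof (rule ccontr)
    assume "\<not> ?thesis"
    then have "v \<bullet> v = 0" by (simp add: eigenbasis_inner[OF assms(2), of v v])
    with v show False by simp
  qed
  then obtain e where e: "e \<in> E" "v \<bullet> e \<noteq> 0" by blast
  have "\<mu> * (v \<bullet> e) = v \<bullet> (B *v e)"
    using symmetric_inner[OF assms(1), of v e] v by simp
  also have "\<dots> = l e * (v \<bullet> e)"
    using e assms(2) by (simp add: eigenbasis_def)
  finally show "\<mu> \<in> l ` E" using e by simp
next
  fix \<mu> assume "\<mu> \<in> l ` E"
  then obtain e where "e \<in> E" "\<mu> = l e" by blast
  then have "B *v e = \<mu> *\<^sub>R e" "norm e = 1"
    using assms(2) by (auto simp: eigenbasis_def)
  then show "\<mu> \<in> eigvals B"
    unfolding eigvals_def by (auto intro!: exI[of _ e])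
qed

lemma eigenbasis_nonempty:
  fixes B :: "real^'d^'d"
  assumes "eigenbasis B E l"
  shows "E \<noteq> {}"
proof
  assume "E = {}"
  then have "x = 0" for x :: "real^'d"
    using assms by (simp add: eigenbasis_def)
  \<comment> \<open>Index types are inhabited, so the space has positive dimension and any axis
    vector is a witness.\<close>
  moreover have "(axis undefined 1 :: real^'d) \<noteq> 0"
    by (simp add: axis_eq_0_iff)
  ultimately show False by blast
qed

lemma finite_eigvals:
  assumes "transpose B = B"
  shows "finite (eigvals B)"
proof -
  obtain E l where E: "eigenbasis B E l" using eigenbasis_exists[OF assms] by blast
  then have "finite E" by (simp add: eigenbasis_def)
  then show ?thesis by (simp add: eigvals_eigenbasis[OF assms E])
qed

lemma eigvals_nonempty:
  assumes "transpose B = B"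
  shows "eigvals B \<noteq> {}"
proof -
  obtain E l where E: "eigenbasis B E l" using eigenbasis_exists[OF assms] by blast
  then show ?thesis by (simp add: eigvals_eigenbasis[OF assms E] eigenbasis_nonempty[OF E])
qed

lemma eigvals_nonneg:
  assumes "sym_psd B" "\<mu> \<in> eigvals B"
  shows "0 \<le> \<mu>"
proof -
  have sym: "transpose B = B" using assms by (simp add: sym_psd_def)
  obtain E l where E: "eigenbasis B E l" using eigenbasis_exists[OF sym] by blast
  then show ?thesis
    using assms eigenbasis_nonneg[OF assms(1) E] by (auto simp: eigvals_eigenbasis[OF sym E])
qed

text \<open>Guarantees that the minimum in \<open>lambda_min_pos\<close> ranges over a non-empty
  set.\<close>

lemma eigvals_nonzero:
  fixes B :: "real^'d^'d"
  assumes "transpose B = B" "B \<noteq> 0"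
  shows "eigvals B - {0} \<noteq> {}"
proof
  assume "eigvals B - {0} = {}"
  obtain E l where E: "eigenbasis B E l" using eigenbasis_exists[OF assms(1)] by blast
  have "l e = 0" if "e \<in> E" for e
    using eigvals_eigenbasis[OF assms(1) E] \<open>eigvals B - {0} = {}\<close> that by auto
  then have "B *v x = 0 *v x" for x
    by (simp add: eigenbasis_mult[OF E])
  with assms(2) show False by (metis matrix_eq)
qed

lemma lambda_max_mem: "transpose B = B \<Longrightarrow> lambda_max B \<in> eigvals B"
  by (simp add: lambda_max_def finite_eigvals eigvals_nonempty)

lemma lambda_min_pos_mem:
  "transpose B = B \<Longrightarrow> B \<noteq> 0 \<Longrightarrow> lambda_min_pos B \<in> eigvals B - {0}"
  unfolding lambda_min_pos_def by (intro Min_in eigvals_nonzero finite_Diff finite_eigvals)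

lemma lambda_max_ge: "transpose B = B \<Longrightarrow> \<mu> \<in> eigvals B \<Longrightarrow> \<mu> \<le> lambda_max B"
  by (simp add: lambda_max_def finite_eigvals)

lemma lambda_min_pos_le:
  "transpose B = B \<Longrightarrow> \<mu> \<in> eigvals B \<Longrightarrow> \<mu> \<noteq> 0 \<Longrightarrow> lambda_min_pos B \<le> \<mu>"
  by (simp add: lambda_min_pos_def finite_eigvals)

lemma lambda_min_pos_pos: "sym_psd B \<Longrightarrow> B \<noteq> 0 \<Longrightarrow> 0 < lambda_min_pos B"
  using lambda_min_pos_mem[of B] eigvals_nonneg[of B] by (force simp: sym_psd_def)

lemma lambda_min_pos_le_max: "sym_psd B \<Longrightarrow> B \<noteq> 0 \<Longrightarrow> lambda_min_pos B \<le> lambda_max B"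
  using lambda_min_pos_mem[of B] lambda_max_ge[of B] by (force simp: sym_psd_def)

lemma form_le_lambda_max:
  assumes "transpose B = B"
  shows "x \<bullet> (B *v x) \<le> lambda_max B * (x \<bullet> x)"
proof -
  obtain E l where E: "eigenbasis B E l" using eigenbasis_exists[OF assms(1)] by blast
  have "l e \<le> lambda_max B" if "e \<in> E" for e
    using lambda_max_ge[OF assms] that by (simp add: eigvals_eigenbasis[OF assms E])
  then show ?thesis
    unfolding eigenbasis_form[OF E, of x x] unfolding eigenbasis_inner[OF E, of x x]
    by (auto simp: sum_distrib_left intro!: sum_mono mult_right_mono)
qed

text \<open>Orthogonality to the kernel removes the components with eigenvalue zero, so only
  non-zero eigenvalues contribute to the form.\<close>

lemma form_ge_lambda_min_pos:
  assumes "sym_psd B" and orth: "\<And>k. B *v k = 0 \<Longrightarrow> x \<bullet> k = 0"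
  shows "lambda_min_pos B * (x \<bullet> x) \<le> x \<bullet> (B *v x)"
proof -
  have sym: "transpose B = B" using assms by (simp add: sym_psd_def)
  obtain E l where E: "eigenbasis B E l" using eigenbasis_exists[OF sym] by blast
  have "lambda_min_pos B * ((x \<bullet> e) * (x \<bullet> e)) \<le> l e * ((x \<bullet> e) * (x \<bullet> e))" if "e \<in> E" for e
  proof (cases "l e = 0")
    case True
    with E that have "B *v e = 0" by (simp add: eigenbasis_def)
    then show ?thesis by (simp add: orth)
  next
    case False
    then have "lambda_min_pos B \<le> l e"
      using lambda_min_pos_le[OF sym] that by (simp add: eigvals_eigenbasis[OF sym E])
    then show ?thesis by (intro mult_right_mono) auto
  qed
  then show ?thesis
    unfolding eigenbasis_form[OF E, of x x] unfolding eigenbasis_inner[OF E, of x x]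
    by (auto simp: sum_distrib_left intro!: sum_mono)
qed

text \<open>In an eigenbasis the form is a sum of non-negative terms, so each must vanish. This lets
  kernels be compared through quadratic forms alone.\<close>

lemma psd_form_eq_0:
  assumes "sym_psd B"
  shows "x \<bullet> (B *v x) = 0 \<longleftrightarrow> B *v x = 0"
proof
  assume 0: "x \<bullet> (B *v x) = 0"
  have sym: "transpose B = B" using assms by (simp add: sym_psd_def)
  obtain E l where E: "eigenbasis B E l" using eigenbasis_exists[OF sym] by blast
  have fin: "finite E" using E by (simp add: eigenbasis_def)
  have "\<forall>e\<in>E. l e * ((x \<bullet> e) * (x \<bullet> e)) = 0"
    using 0 eigenbasis_nonneg[OF assms E]
    by (subst sum_nonneg_eq_0_iff[symmetric]) (auto simp: fin eigenbasis_form[OF E, of x x])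
  then show "B *v x = 0"
    by (auto simp: eigenbasis_mult[OF E] intro!: sum.neutral)
qed simp

section \<open>Condition numbers under two-sided Loewner bounds\<close>

definition condition_number :: "real^'d^'d \<Rightarrow> real" where
  "condition_number B = lambda_max B / lambda_min_pos B"

lemma condition_number_ge_1: "sym_psd B \<Longrightarrow> B \<noteq> 0 \<Longrightarrow> 1 \<le> condition_number B"
  using lambda_min_pos_pos[of B] lambda_min_pos_le_max[of B] by (simp add: condition_number_def)

text \<open>The upper bound controls the largest eigenvalue. It also puts the kernel of
  \<open>B\<close> inside that of \<open>C\<close>; hence an eigenvector of \<open>C\<close> for a
  non-zero eigenvalue is orthogonal to the kernel of \<open>B\<close>, and the lower bound controls
  the smallest non-zero eigenvalue.\<close>

lemma condition_number_le:
  fixes B C :: "real^'d^'d"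
  assumes B: "sym_psd B" "B \<noteq> 0" and C: "sym_psd C" "C \<noteq> 0" and p: "0 < p"
    and lower: "\<And>x. p * (x \<bullet> (B *v x)) \<le> x \<bullet> (C *v x)"
    and upper: "\<And>x. x \<bullet> (C *v x) \<le> q * (x \<bullet> (B *v x))"
  shows "condition_number C \<le> q / p * condition_number B"
proof -
  have sB: "transpose B = B" and sC: "transpose C = C"
    using B C by (auto simp: sym_psd_def)
  \<comment> \<open>Some vector has a positive form under \<open>B\<close>; there the two bounds
    give \<open>p \<le> q\<close>.\<close>
  have q: "0 \<le> q"
  proof -
    obtain x where "B *v x \<noteq> 0" using B(2) by (metis matrix_eq matrix_vector_mult_0)
    then have "0 < x \<bullet> (B *v x)"
      using psd_form_eq_0[OF B(1), of x] B(1) by (auto simp: sym_psd_def less_le)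
    moreover have "p * (x \<bullet> (B *v x)) \<le> q * (x \<bullet> (B *v x))"
      using lower[of x] upper[of x] by linarith
    ultimately show ?thesis using p by (simp add: mult_le_cancel_right)
  qed
  obtain v where v: "v \<noteq> 0" "C *v v = lambda_max C *\<^sub>R v"
    using lambda_max_mem[OF sC] by (auto simp: eigvals_def)
  have "lambda_max C * (v \<bullet> v) \<le> q * (v \<bullet> (B *v v))"
    using upper[of v] v by simp
  also have "\<dots> \<le> q * (lambda_max B * (v \<bullet> v))"
    using form_le_lambda_max[OF sB] q by (intro mult_left_mono)
  finally have max: "lambda_max C \<le> q * lambda_max B"
    using v by (simp add: mult.assoc[symmetric] mult_le_cancel_right)
  obtain w where w: "w \<noteq> 0" "C *v w = lambda_min_pos C *\<^sub>R w"
    using lambda_min_pos_mem[OF sC C(2)] by (auto simp: eigvals_def)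
  have "w \<bullet> k = 0" if "B *v k = 0" for k
  proof -
    have "k \<bullet> (C *v k) = 0"
      using upper[of k] C(1) that by (auto simp: sym_psd_def intro: antisym)
    then have "C *v k = 0" by (simp add: psd_form_eq_0[OF C(1)])
    then have "lambda_min_pos C * (w \<bullet> k) = 0"
      using symmetric_inner[OF sC, of w k] w by simp
    then show ?thesis using lambda_min_pos_pos[OF C] by simp
  qed
  then have "lambda_min_pos B * (w \<bullet> w) \<le> w \<bullet> (B *v w)"
    by (rule form_ge_lambda_min_pos[OF B(1)])
  then have "p * (lambda_min_pos B * (w \<bullet> w)) \<le> p * (w \<bullet> (B *v w))"
    using p by (intro mult_left_mono) auto
  also have "\<dots> \<le> lambda_min_pos C * (w \<bullet> w)"
    using lower[of w] w by simp
  finally have min: "p * lambda_min_pos B \<le> lambda_min_pos C"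
    using w by (simp add: mult.assoc[symmetric] mult_le_cancel_right)
  have pos: "0 < lambda_min_pos B" by (rule lambda_min_pos_pos[OF B])
  have "lambda_max C / lambda_min_pos C \<le> (q * lambda_max B) / (p * lambda_min_pos B)"
    using max min p q pos lambda_min_pos_le_max[OF B] by (intro frac_le) auto
  then show ?thesis by (simp add: condition_number_def)
qed

subsection \<open>The Hessian of the averaged Moreau envelope\<close>

definition resolvent :: "real \<Rightarrow> real^'d^'d \<Rightarrow> real^'d^'d" where
  "resolvent \<gamma> B = matrix_inv (mat 1 + \<gamma> *\<^sub>R B)"

text \<open>Equal to \<open>(I - (I + \<gamma> B)\<^sup>-\<^sup>1) / \<gamma>\<close> for \<open>\<gamma> > 0\<close>, in a form that also makes sense at \<open>\<gamma> = 0\<close>.\<close>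

definition envelope_matrix :: "real \<Rightarrow> real^'d^'d \<Rightarrow> real^'d^'d" where
  "envelope_matrix \<gamma> B = B ** resolvent \<gamma> B"

text \<open>For positive semidefinite \<open>B\<close> the matrix
  \<open>mat 1 + \<gamma> *\<^sub>R B\<close> is positive definite, hence injective, hence
  invertible.\<close>

lemma resolvent_inverse:
  fixes B :: "real^'d^'d"
  assumes "sym_psd B" "0 \<le> \<gamma>"
  shows "(mat 1 + \<gamma> *\<^sub>R B) ** resolvent \<gamma> B = mat 1"
    and "resolvent \<gamma> B ** (mat 1 + \<gamma> *\<^sub>R B) = mat 1"
proof -
  let ?M = "mat 1 + \<gamma> *\<^sub>R B"
  have "x = 0" if "?M *v x = 0" for x
  proof -
    have "x \<bullet> x + \<gamma> * (x \<bullet> (B *v x)) = x \<bullet> (?M *v x)"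
      by (simp add: matrix_vector_mult_add_rdistrib inner_add_right flip: scaleR_matrix_vector_assoc)
    then have "x \<bullet> x + \<gamma> * (x \<bullet> (B *v x)) = 0"
      by (simp add: that)
    moreover have "0 \<le> \<gamma> * (x \<bullet> (B *v x))"
      using assms by (simp add: sym_psd_def)
    ultimately show "x = 0"
      using inner_ge_zero[of x] inner_eq_zero_iff[of x] by linarith
  qed
  then have "\<exists>R. R ** ?M = mat 1"
    by (simp add: matrix_left_invertible_ker)
  then have "\<exists>R. ?M ** R = mat 1 \<and> R ** ?M = mat 1"
    using matrix_left_right_inverse by blast
  \<comment> \<open>\<open>matrix_inv\<close> is a choice among two-sided inverses, so existence
    yields both identities.\<close>
  then have "?M ** matrix_inv ?M = mat 1 \<and> matrix_inv ?M ** ?M = mat 1"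
    unfolding matrix_inv_def by (rule someI_ex)
  then show "?M ** resolvent \<gamma> B = mat 1" "resolvent \<gamma> B ** ?M = mat 1"
    by (auto simp: resolvent_def)
qed

lemma resolvent_mult:
  fixes B :: "real^'d^'d"
  assumes "sym_psd B" "0 \<le> \<gamma>"
  shows "resolvent \<gamma> B *v x + \<gamma> *\<^sub>R (B *v (resolvent \<gamma> B *v x)) = x"
proof -
  have "(mat 1 + \<gamma> *\<^sub>R B) *v (resolvent \<gamma> B *v x) = x"
    by (simp add: matrix_vector_mul_assoc resolvent_inverse[OF assms])
  then show ?thesis
    by (simp add: matrix_vector_mult_add_rdistrib scaleR_matrix_vector_assoc)
qed

lemma envelope_matrix_0: "sym_psd B \<Longrightarrow> envelope_matrix 0 B = B"
  using resolvent_inverse(1)[of B 0] by (simp add: envelope_matrix_def)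

lemma sym_psdI_eigenbasis:
  fixes B :: "real^'d^'d"
  assumes "eigenbasis B E l" "\<And>e. e \<in> E \<Longrightarrow> 0 \<le> l e"
  shows "sym_psd B"
proof -
  have "(transpose B *v x) \<bullet> y = (B *v x) \<bullet> y" for x y
  proof -
    have "(transpose B *v x) \<bullet> y = x \<bullet> (B *v y)"
      by (metis dot_lmul_matrix vector_transpose_matrix transpose_transpose)
    also have "\<dots> = y \<bullet> (B *v x)"
      by (simp add: eigenbasis_form[OF assms(1)] mult.commute)
    finally show ?thesis by (simp add: inner_commute)
  qed
  then have "transpose B *v x = B *v x" for x
    by (metis vector_eq_rdot)
  then have "transpose B = B"
    by (metis matrix_eq)
  moreover have "0 \<le> x \<bullet> (B *v x)" for x
    using assms(2) by (auto simp: eigenbasis_form[OF assms(1)] intro!: sum_nonneg)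
  ultimately show ?thesis by (simp add: sym_psd_def)
qed

text \<open>\<open>B\<close> and its resolvent share eigenvectors. One basis thus serves all
  stepsizes, and forms at different stepsizes can be compared term by term.\<close>

lemma eigenbasis_envelope_matrix:
  assumes "sym_psd B" "0 \<le> \<gamma>" and E: "eigenbasis B E l"
  shows "eigenbasis (envelope_matrix \<gamma> B) E (\<lambda>e. l e / (1 + \<gamma> * l e))"
proof -
  have "envelope_matrix \<gamma> B *v e = (l e / (1 + \<gamma> * l e)) *\<^sub>R e" if "e \<in> E" for e
  proof -
    let ?c = "1 + \<gamma> * l e"
    have Be: "B *v e = l e *\<^sub>R e" using E that by (simp add: eigenbasis_def)
    have "0 \<le> \<gamma> * l e" using eigenbasis_nonneg[OF assms(1) E that] assms(2) by simp
    then have c: "?c \<noteq> 0" by linarith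
    have "(mat 1 + \<gamma> *\<^sub>R B) *v e = ?c *\<^sub>R e"
      by (simp add: matrix_vector_mult_add_rdistrib Be scaleR_add_left flip: scaleR_matrix_vector_assoc)
    then have "resolvent \<gamma> B *v (?c *\<^sub>R e) = e"
      by (metis matrix_vector_mul_assoc matrix_vector_mul_lid resolvent_inverse(2)[OF assms(1,2)])
    then have "?c *\<^sub>R (resolvent \<gamma> B *v e) = e"
      by (simp add: matrix_vector_mult_scaleR)
    then have "resolvent \<gamma> B *v e = (1 / ?c) *\<^sub>R e"
      using c by (metis divideR_right inverse_eq_divide)
    then have "envelope_matrix \<gamma> B *v e = B *v ((1 / ?c) *\<^sub>R e)"
      unfolding envelope_matrix_def by (metis matrix_vector_mul_assoc)
    then show ?thesis
      by (simp add: matrix_vector_mult_scaleR Be)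
  qed
  then show ?thesis
    using E by (simp add: eigenbasis_def)
qed

lemma sym_psd_envelope_matrix:
  assumes "sym_psd B" "0 \<le> \<gamma>"
  shows "sym_psd (envelope_matrix \<gamma> B)"
proof -
  obtain E l where E: "eigenbasis B E l"
    using eigenbasis_exists assms by (metis sym_psd_def)
  show ?thesis
    using eigenbasis_nonneg[OF assms(1) E] assms(2)
    by (intro sym_psdI_eigenbasis[OF eigenbasis_envelope_matrix[OF assms E]]) simp
qed

lemma stepsize_ratio_antimono:
  fixes \<gamma> \<gamma>' u v :: real
  assumes "0 \<le> \<gamma>" "\<gamma> \<le> \<gamma>'" "0 \<le> u" "u \<le> v"
  shows "(1 + \<gamma> * v) / (1 + \<gamma>' * v) \<le> (1 + \<gamma> * u) / (1 + \<gamma>' * u)"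
proof -
  have "0 \<le> \<gamma>' * u" "0 \<le> \<gamma>' * v" using assms by auto
  then have "0 < 1 + \<gamma>' * u" "0 < 1 + \<gamma>' * v" by linarith+
  \<comment> \<open>This product is exactly the difference of the two sides after
    cross-multiplication.\<close>
  moreover have "0 \<le> (\<gamma>' - \<gamma>) * (v - u)" using assms by simp
  then have "(1 + \<gamma> * v) * (1 + \<gamma>' * u) \<le> (1 + \<gamma> * u) * (1 + \<gamma>' * v)"
    by (simp add: algebra_simps)
  ultimately show ?thesis by (simp add: divide_simps)
qed

text \<open>On an eigenvector for \<open>\<lambda>\<close> the envelope matrix acts as \<open>\<lambda> / (1 + \<gamma> \<lambda>)\<close>, so passing from \<open>\<gamma>\<close> to
  \<open>\<gamma>'\<close> scales it by \<open>(1 + \<gamma> \<lambda>) / (1 + \<gamma>' \<lambda>)\<close>, which is decreasing in \<open>\<lambda>\<close>.\<close>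

lemma envelope_matrix_form_bounds:
  fixes B :: "real^'d^'d"
  assumes B: "sym_psd B" and \<gamma>: "0 \<le> \<gamma>" "\<gamma> \<le> \<gamma>'" and m: "0 \<le> m"
    and spec: "\<And>\<mu>. \<mu> \<in> eigvals B \<Longrightarrow> \<mu> \<noteq> 0 \<Longrightarrow> m \<le> \<mu> \<and> \<mu> \<le> L"
  shows "(1 + \<gamma> * L) / (1 + \<gamma>' * L) * (x \<bullet> (envelope_matrix \<gamma> B *v x))
           \<le> x \<bullet> (envelope_matrix \<gamma>' B *v x)" (is "?p * _ \<le> _")
    and "x \<bullet> (envelope_matrix \<gamma>' B *v x)
           \<le> (1 + \<gamma> * m) / (1 + \<gamma>' * m) * (x \<bullet> (envelope_matrix \<gamma> B *v x))" (is "_ \<le> ?q * _")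
proof -
  have sym: "transpose B = B" using B by (simp add: sym_psd_def)
  obtain E l where E: "eigenbasis B E l" using eigenbasis_exists[OF sym] by blast
  have \<gamma>': "0 \<le> \<gamma>'" using \<gamma> by simp
  have bound: "?p * (l e / (1 + \<gamma> * l e)) \<le> l e / (1 + \<gamma>' * l e) \<and>
      l e / (1 + \<gamma>' * l e) \<le> ?q * (l e / (1 + \<gamma> * l e))" if e: "e \<in> E" for e
  \<comment> \<open>A zero eigenvalue may lie outside \<open>[m, L]\<close>, but then every term of
    both inequalities is zero.\<close>
  proof (cases "l e = 0")
    case False
    have le: "0 \<le> l e" by (rule eigenbasis_nonneg[OF B E e])
    have spec': "m \<le> l e" "l e \<le> L"
      using spec[of "l e"] e False by (auto simp: eigvals_eigenbasis[OF sym E])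
    have pos: "0 < 1 + \<gamma> * l e" "0 \<le> l e / (1 + \<gamma> * l e)"
      using le \<gamma> by (simp_all add: add_pos_nonneg)
    have eq: "l e / (1 + \<gamma>' * l e) = (1 + \<gamma> * l e) / (1 + \<gamma>' * l e) * (l e / (1 + \<gamma> * l e))"
      using pos by simp
    show ?thesis
      unfolding eq
      using stepsize_ratio_antimono[OF \<gamma> le spec'(2)] stepsize_ratio_antimono[OF \<gamma> m spec'(1)]
        pos(2) by (intro conjI mult_right_mono)
  qed simp
  note form = eigenbasis_form[OF eigenbasis_envelope_matrix[OF B _ E]]
  show "?p * (x \<bullet> (envelope_matrix \<gamma> B *v x)) \<le> x \<bullet> (envelope_matrix \<gamma>' B *v x)"
    unfolding form[OF \<gamma>(1)] form[OF \<gamma>'] sum_distrib_left mult.assoc[symmetric, of ?p]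
    by (intro sum_mono mult_right_mono bound[THEN conjunct1]) auto
  show "x \<bullet> (envelope_matrix \<gamma>' B *v x) \<le> ?q * (x \<bullet> (envelope_matrix \<gamma> B *v x))"
    unfolding form[OF \<gamma>(1)] form[OF \<gamma>'] sum_distrib_left mult.assoc[symmetric, of ?q]
    by (intro sum_mono mult_right_mono bound[THEN conjunct2]) auto
qed

section \<open>Averages of envelope matrices\<close>

lemma avg_matrix_mult:
  fixes A :: "nat \<Rightarrow> real^'d^'d"
  shows "avg_matrix n A *v x = (1 / real n) *\<^sub>R (\<Sum>i=1..n. A i *v x)"
proof -
  have "(\<Sum>i\<in>I. A i) *v x = (\<Sum>i\<in>I. A i *v x)" if "finite I" for I
    using that by (induction I) (auto simp: matrix_vector_mult_add_rdistrib)
  then show ?thesis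
    by (simp add: avg_matrix_def flip: scaleR_matrix_vector_assoc)
qed

lemma avg_matrix_form:
  "y \<bullet> (avg_matrix n A *v x) = 1 / real n * (\<Sum>i=1..n. y \<bullet> (A i *v x))"
  by (simp add: avg_matrix_mult inner_sum_right)

lemma sym_psd_avg_matrix:
  fixes A :: "nat \<Rightarrow> real^'d^'d"
  assumes "\<And>i. i \<in> {1..n} \<Longrightarrow> sym_psd (A i)"
  shows "sym_psd (avg_matrix n A)"
proof -
  have "transpose (avg_matrix n A) = (1 / real n) *\<^sub>R (\<Sum>i=1..n. transpose (A i))"
    by (simp add: avg_matrix_def transpose_def vec_eq_iff)
  also have "\<dots> = avg_matrix n A"
    using assms by (simp add: avg_matrix_def sym_psd_def)
  finally show ?thesis
    using assms by (auto simp: sym_psd_def avg_matrix_form intro!: sum_nonneg divide_nonneg_nonneg)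
qed

text \<open>If a sum of positive semidefinite forms vanishes at \<open>v\<close>, every summand
  does. The envelope matrix of \<open>A i\<close> has the same kernel as \<open>A i\<close>, so an
  eigenvector of \<open>A i\<close> for a non-zero eigenvalue gives a contradiction.\<close>

lemma avg_envelope_matrix_nonzero:
  fixes A :: "nat \<Rightarrow> real^'d^'d"
  assumes psd: "\<And>i. i \<in> {1..n} \<Longrightarrow> sym_psd (A i)" and \<gamma>: "0 \<le> \<gamma>"
    and i: "i \<in> {1..n}" "A i \<noteq> 0"
  shows "avg_matrix n (\<lambda>i. envelope_matrix \<gamma> (A i)) \<noteq> 0"
proof
  assume 0: "avg_matrix n (\<lambda>i. envelope_matrix \<gamma> (A i)) = 0"
  have env: "sym_psd (envelope_matrix \<gamma> (A j))" if "j \<in> {1..n}" for j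
    using sym_psd_envelope_matrix[OF psd[OF that] \<gamma>] .
  have sym: "transpose (A i) = A i" using psd[OF i(1)] by (simp add: sym_psd_def)
  obtain v \<mu> where v: "v \<noteq> 0" "A i *v v = \<mu> *\<^sub>R v" "\<mu> \<noteq> 0"
    using eigvals_nonzero[OF sym i(2)] by (auto simp: eigvals_def)
  have "(\<Sum>j=1..n. v \<bullet> (envelope_matrix \<gamma> (A j) *v v)) = 0"
    using avg_matrix_form[of v n "\<lambda>i. envelope_matrix \<gamma> (A i)" v] i by (simp add: 0)
  then have "v \<bullet> (envelope_matrix \<gamma> (A i) *v v) = 0"
    using env i by (subst (asm) sum_nonneg_eq_0_iff) (auto simp: sym_psd_def)
  then have k: "envelope_matrix \<gamma> (A i) *v v = 0"
    by (simp add: psd_form_eq_0[OF env[OF i(1)]])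
  obtain E l where E: "eigenbasis (A i) E l" using eigenbasis_exists[OF sym] by blast
  note E' = eigenbasis_envelope_matrix[OF psd[OF i(1)] \<gamma> E]
  have "l e * (v \<bullet> e) = 0" if e: "e \<in> E" for e
  proof -
    have "0 \<le> \<gamma> * l e" using eigenbasis_nonneg[OF psd[OF i(1)] E e] \<gamma> by simp
    then have "1 + \<gamma> * l e \<noteq> 0" by linarith
    moreover have "v \<bullet> (envelope_matrix \<gamma> (A i) *v e) = e \<bullet> (envelope_matrix \<gamma> (A i) *v v)"
      by (metis env i(1) inner_commute sym_psd_def symmetric_inner)
    ultimately show ?thesis
      using E' e k by (simp add: eigenbasis_def)
  qed
  then have "A i *v v = 0"
    unfolding eigenbasis_mult[OF E] by (intro sum.neutral) simp
  with v show False by simp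
qed

text \<open>The bounds for single matrices have factors independent of \<open>i\<close>, so they
  survive averaging and feed \<open>condition_number_le\<close>.\<close>

lemma condition_number_envelope:
  fixes A :: "nat \<Rightarrow> real^'d^'d"
  assumes psd: "\<And>i. i \<in> {1..n} \<Longrightarrow> sym_psd (A i)" and nz: "\<exists>i\<in>{1..n}. A i \<noteq> 0"
    and \<gamma>: "0 \<le> \<gamma>" "\<gamma> \<le> \<gamma>'" and mL: "0 \<le> m" "0 \<le> L"
    and spec: "\<And>i \<mu>. i \<in> {1..n} \<Longrightarrow> \<mu> \<in> eigvals (A i) \<Longrightarrow> \<mu> \<noteq> 0 \<Longrightarrow> m \<le> \<mu> \<and> \<mu> \<le> L"
  defines "\<kappa> \<equiv> \<lambda>\<gamma>. condition_number (avg_matrix n (\<lambda>i. envelope_matrix \<gamma> (A i)))"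
    and "r \<equiv> \<lambda>t. (1 + \<gamma> * t) / (1 + \<gamma>' * t)"
  shows "\<kappa> \<gamma>' \<le> r m / r L * \<kappa> \<gamma>" and "\<kappa> \<gamma> \<le> r m / r L * \<kappa> \<gamma>'"
proof -
  let ?H = "\<lambda>\<gamma>. avg_matrix n (\<lambda>i. envelope_matrix \<gamma> (A i))"
  have \<gamma>': "0 \<le> \<gamma>'" using \<gamma> by simp
  have H: "sym_psd (?H \<delta>)" "?H \<delta> \<noteq> 0" if "0 \<le> \<delta>" for \<delta>
    using sym_psd_avg_matrix[of n "\<lambda>i. envelope_matrix \<delta> (A i)"] nz psd that
      sym_psd_envelope_matrix avg_envelope_matrix_nonzero[OF psd that] by auto
  have r: "0 < r m" "0 < r L"
    using \<gamma> mL by (auto simp: r_def intro!: divide_pos_pos add_pos_nonneg)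
  have lower: "r L * (x \<bullet> (?H \<gamma> *v x)) \<le> x \<bullet> (?H \<gamma>' *v x)"
    and upper: "x \<bullet> (?H \<gamma>' *v x) \<le> r m * (x \<bullet> (?H \<gamma> *v x))" for x
  proof -
    have "r L * (\<Sum>i=1..n. x \<bullet> (envelope_matrix \<gamma> (A i) *v x))
        \<le> (\<Sum>i=1..n. x \<bullet> (envelope_matrix \<gamma>' (A i) *v x))"
      unfolding sum_distrib_left r_def
      by (intro sum_mono envelope_matrix_form_bounds(1)[OF psd \<gamma> mL(1) spec])
    then show "r L * (x \<bullet> (?H \<gamma> *v x)) \<le> x \<bullet> (?H \<gamma>' *v x)"
      by (simp add: avg_matrix_form divide_right_mono)
    have "(\<Sum>i=1..n. x \<bullet> (envelope_matrix \<gamma>' (A i) *v x))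
        \<le> r m * (\<Sum>i=1..n. x \<bullet> (envelope_matrix \<gamma> (A i) *v x))"
      unfolding sum_distrib_left r_def
      by (intro sum_mono envelope_matrix_form_bounds(2)[OF psd \<gamma> mL(1) spec])
    then show "x \<bullet> (?H \<gamma>' *v x) \<le> r m * (x \<bullet> (?H \<gamma> *v x))"
      by (simp add: avg_matrix_form divide_right_mono)
  qed
  show "\<kappa> \<gamma>' \<le> r m / r L * \<kappa> \<gamma>"
    unfolding \<kappa>_def by (rule condition_number_le[OF H[OF \<gamma>(1)] H[OF \<gamma>'] r(2) lower upper])
  \<comment> \<open>Inverting the Loewner bounds exchanges the roles of the two stepsizes: the lower
    factor is now \<open>1 / r m\<close> and the upper one \<open>1 / r L\<close>, with the same
    quotient.\<close>
  have "condition_number (?H \<gamma>) \<le> (1 / r L) / (1 / r m) * condition_number (?H \<gamma>')"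
    using r lower upper
    by (intro condition_number_le[OF H[OF \<gamma>'] H[OF \<gamma>(1)]]) (auto simp: field_simps)
  then show "\<kappa> \<gamma> \<le> r m / r L * \<kappa> \<gamma>'"
    unfolding \<kappa>_def by simp
qed

section \<open>Proximal points and derivatives of the Moreau envelope\<close>

lemma quad_add:
  assumes "transpose B = B"
  shows "quad B c (w + d) = quad B c w + d \<bullet> (B *v w - c) + 1 / 2 * (d \<bullet> (B *v d))"
  using symmetric_inner[OF assms, of w d]
  by (simp add: quad_def matrix_vector_right_distrib inner_add_left inner_add_right
      inner_diff_right inner_commute algebra_simps)

lemma GDERIV_quad:
  fixes B :: "real^'d^'d"
  assumes "transpose B = B"
  shows "GDERIV (quad B c) w :> B *v w - c"
  unfolding gderiv_def quad_def
  using symmetric_inner[OF assms]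
  by (auto intro!: derivative_eq_intros bounded_linear_imp_has_derivative
      bounded_linear.has_derivative[OF matrix_vector_mul_bounded_linear]
      simp: inner_diff_right inner_commute fun_eq_iff)

text \<open>\<open>w x\<close> is the proximal point, obtained by solving the stationarity equation
  \<open>(I + \<gamma> B) w = x + \<gamma> c\<close>. Around it the linear terms of the exact Taylor
  expansion cancel and the remainder is non-negative, so the infimum is attained.\<close>

lemma moreau_quad:
  fixes B :: "real^'d^'d" and c :: "real^'d"
  assumes B: "sym_psd B" and \<gamma>: "0 < \<gamma>"
  defines "w \<equiv> \<lambda>x. resolvent \<gamma> B *v (x + \<gamma> *\<^sub>R c)"
  shows "moreau \<gamma> (quad B c) x = quad B c (w x) + 1 / (2 * \<gamma>) * (norm (w x - x))\<^sup>2"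
    and "B *v w x - c = (1 / \<gamma>) *\<^sub>R (x - w x)"
proof -
  have sym: "transpose B = B" using B by (simp add: sym_psd_def)
  have "w x + \<gamma> *\<^sub>R (B *v w x) = x + \<gamma> *\<^sub>R c"
    unfolding w_def using resolvent_mult[OF B] \<gamma> by simp
  then have "\<gamma> *\<^sub>R (B *v w x - c) = x - w x"
    by (simp add: algebra_simps)
  then have "(1 / \<gamma>) *\<^sub>R (\<gamma> *\<^sub>R (B *v w x - c)) = (1 / \<gamma>) *\<^sub>R (x - w x)"
    by simp
  then show opt: "B *v w x - c = (1 / \<gamma>) *\<^sub>R (x - w x)"
    using \<gamma> by simp
  show "moreau \<gamma> (quad B c) x = quad B c (w x) + 1 / (2 * \<gamma>) * (norm (w x - x))\<^sup>2"
    unfolding moreau_def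
  proof (rule cInf_eq_minimum)
    fix y assume "y \<in> range (\<lambda>z. quad B c z + 1 / (2 * \<gamma>) * (norm (z - x))\<^sup>2)"
    then obtain z where y: "y = quad B c z + 1 / (2 * \<gamma>) * (norm (z - x))\<^sup>2" by blast
    define d where "d = z - w x"
    have z: "z = w x + d" by (simp add: d_def)
    have "(norm (u + d))\<^sup>2 = (norm u)\<^sup>2 + 2 * (d \<bullet> u) + (norm d)\<^sup>2" for u
      by (simp add: power2_norm_eq_inner inner_add_left inner_add_right inner_commute)
    moreover have "z - x = (w x - x) + d" by (simp add: z)
    ultimately have norm: "(norm (z - x))\<^sup>2 = (norm (w x - x))\<^sup>2 + 2 * (d \<bullet> (w x - x)) + (norm d)\<^sup>2"
      by metis
    have neg: "d \<bullet> (w x - x) = - (d \<bullet> (x - w x))"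
      by (simp add: inner_diff_right)
    have "y = quad B c (w x) + 1 / (2 * \<gamma>) * (norm (w x - x))\<^sup>2
        + 1 / 2 * (d \<bullet> (B *v d)) + 1 / (2 * \<gamma>) * (norm d)\<^sup>2"
      unfolding y norm neg unfolding z quad_add[OF sym] opt inner_scaleR_right
      using \<gamma> by (simp add: field_simps)
    moreover have "0 \<le> d \<bullet> (B *v d)" using B by (simp add: sym_psd_def)
    ultimately show "quad B c (w x) + 1 / (2 * \<gamma>) * (norm (w x - x))\<^sup>2 \<le> y"
      using \<gamma> by simp
  qed blast
qed

lemma GDERIV_moreau_quad:
  fixes B :: "real^'d^'d"
  assumes B: "sym_psd B" and \<gamma>: "0 < \<gamma>"
  shows "GDERIV (moreau \<gamma> (quad B c)) x :> (1 / \<gamma>) *\<^sub>R (x - resolvent \<gamma> B *v (x + \<gamma> *\<^sub>R c))"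
proof -
  let ?R = "resolvent \<gamma> B"
  define w where "w x = ?R *v (x + \<gamma> *\<^sub>R c)" for x
  have sym: "transpose B = B" using B by (simp add: sym_psd_def)
  note M = moreau_quad[OF B \<gamma>, where c = c, folded w_def]
  have w': "(w has_derivative (\<lambda>h. ?R *v h)) (at x)"
    unfolding w_def[abs_def]
    by (auto intro!: derivative_eq_intros bounded_linear.has_derivative[OF matrix_vector_mul_bounded_linear])
  have "((\<lambda>x. quad B c (w x)) has_derivative (\<lambda>h. (?R *v h) \<bullet> (B *v w x - c))) (at x)"
    using has_derivative_compose[OF w' GDERIV_quad[OF sym, unfolded gderiv_def]] .
  moreover have "((\<lambda>x. 1 / (2 * \<gamma>) * ((w x - x) \<bullet> (w x - x))) has_derivative
      (\<lambda>h. (?R *v h - h) \<bullet> ((1 / \<gamma>) *\<^sub>R (w x - x)))) (at x)"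
    using \<gamma> by (auto intro!: derivative_eq_intros w' simp: inner_commute fun_eq_iff divide_simps)
  ultimately have "((\<lambda>x. quad B c (w x) + 1 / (2 * \<gamma>) * ((w x - x) \<bullet> (w x - x))) has_derivative
      (\<lambda>h. (?R *v h) \<bullet> (B *v w x - c) + (?R *v h - h) \<bullet> ((1 / \<gamma>) *\<^sub>R (w x - x)))) (at x)"
    by (rule has_derivative_add)
  \<comment> \<open>Envelope theorem: by stationarity the terms coming from the motion of
    \<open>w x\<close> cancel, leaving only the explicit dependence on \<open>x\<close>.\<close>
  moreover have "(?R *v h) \<bullet> (B *v w x - c) + (?R *v h - h) \<bullet> ((1 / \<gamma>) *\<^sub>R (w x - x))
      = h \<bullet> ((1 / \<gamma>) *\<^sub>R (x - w x))" for h
    unfolding M(2) by (simp add: inner_diff_left inner_diff_right algebra_simps)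
  moreover have "moreau \<gamma> (quad B c) = (\<lambda>x. quad B c (w x) + 1 / (2 * \<gamma>) * ((w x - x) \<bullet> (w x - x)))"
    by (simp add: fun_eq_iff M(1) power2_norm_eq_inner)
  ultimately show ?thesis
    unfolding gderiv_def by (simp add: w_def)
qed

lemma gradient_eq:
  assumes "GDERIV g x :> D"
  shows "gradient g x = D"
  unfolding gradient_def
proof (rule the_equality)
  fix D' assume "GDERIV g x :> D'"
  then have "(\<lambda>h. h \<bullet> D') = (\<lambda>h. h \<bullet> D)"
    using assms unfolding gderiv_def by (rule has_derivative_unique)
  then show "D' = D" by (metis vector_eq_ldot)
qed (rule assms)

text \<open>The gradient of the averaged envelope is affine; its linear part averages
  \<open>(I - R) / \<gamma>\<close>, which the resolvent identity turns into \<open>A R\<close>. At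
  stepsize zero the resolvent is the identity, matching the convention in
  \<open>env_hessian\<close>.\<close>

lemma env_hessian_eq:
  fixes A :: "nat \<Rightarrow> real^'d^'d"
  assumes psd: "\<And>i. i \<in> {1..n} \<Longrightarrow> sym_psd (A i)" and \<gamma>: "0 \<le> \<gamma>"
  shows "env_hessian n A b \<gamma> = avg_matrix n (\<lambda>i. envelope_matrix \<gamma> (A i))"
proof (cases "\<gamma> = 0")
  case True
  then show ?thesis
    using psd by (simp add: env_hessian_def avg_matrix_def envelope_matrix_0)
next
  case False
  with \<gamma> have \<gamma>: "0 < \<gamma>" by simp
  let ?R = "\<lambda>i. resolvent \<gamma> (A i)" and ?H = "avg_matrix n (\<lambda>i. envelope_matrix \<gamma> (A i))"
  let ?G = "\<lambda>x. (1 / real n) *\<^sub>R (\<Sum>i=1..n. (1 / \<gamma>) *\<^sub>R (x - ?R i *v (x + \<gamma> *\<^sub>R b i)))"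
  have "((\<lambda>x. 1 / real n * (\<Sum>i=1..n. moreau \<gamma> (quad (A i) (b i)) x)) has_derivative
      (\<lambda>h. 1 / real n * (\<Sum>i=1..n. h \<bullet> ((1 / \<gamma>) *\<^sub>R (x - ?R i *v (x + \<gamma> *\<^sub>R b i)))))) (at x)" for x
    using GDERIV_moreau_quad[OF psd \<gamma>, unfolded gderiv_def]
    by (intro has_derivative_mult_right has_derivative_sum) auto
  then have "GDERIV (avg_moreau n A b \<gamma>) x :> ?G x" for x
    unfolding gderiv_def avg_moreau_def[abs_def] by (simp add: inner_sum_right)
  then have grad: "gradient (avg_moreau n A b \<gamma>) = ?G"
    by (intro ext gradient_eq)
  have "(?G has_derivative (\<lambda>h. (1 / real n) *\<^sub>R (\<Sum>i=1..n. (1 / \<gamma>) *\<^sub>R (h - ?R i *v h)))) (at 0)"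
    by (intro has_derivative_scaleR_right has_derivative_sum has_derivative_diff has_derivative_ident
        bounded_linear.has_derivative[OF matrix_vector_mul_bounded_linear])
      (auto intro!: derivative_eq_intros)
  moreover have "(1 / \<gamma>) *\<^sub>R (h - ?R i *v h) = envelope_matrix \<gamma> (A i) *v h" if "i \<in> {1..n}" for i h
  proof -
    have "h - ?R i *v h = \<gamma> *\<^sub>R (A i *v (?R i *v h))"
      using resolvent_mult[OF psd[OF that], of \<gamma> h] \<gamma> by (simp add: algebra_simps)
    then show ?thesis
      using \<gamma> by (simp add: envelope_matrix_def matrix_vector_mul_assoc)
  qed
  ultimately have "(?G has_derivative (\<lambda>h. ?H *v h)) (at 0)"
    by (simp add: avg_matrix_mult)
  then have "frechet_derivative ?G (at 0) = (\<lambda>h. ?H *v h)"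
    by (rule frechet_derivative_at[symmetric])
  then show ?thesis
    using \<gamma> by (simp add: env_hessian_def hessian_def jacobian_def grad)
qed

subsection \<open>Comparison of running times\<close>

text \<open>Provides one interval of positive numbers containing the non-zero spectrum of every
  \<open>A i\<close>.\<close>

lemma spectral_bounds:
  fixes A :: "nat \<Rightarrow> real^'d^'d"
  assumes psd: "\<And>i. i \<in> {1..n} \<Longrightarrow> sym_psd (A i)" and nz: "\<exists>i\<in>{1..n}. A i \<noteq> 0"
  shows "0 < lambda_min_pos_all n A" and "lambda_min_pos_all n A \<le> L_max n A"
    and "\<And>i \<mu>. i \<in> {1..n} \<Longrightarrow> \<mu> \<in> eigvals (A i) \<Longrightarrow> \<mu> \<noteq> 0 \<Longrightarrow>
      lambda_min_pos_all n A \<le> \<mu> \<and> \<mu> \<le> L_max n A"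
proof -
  let ?I = "{i \<in> {1..n}. A i \<noteq> 0}"
  have I: "(\<lambda>i. lambda_min_pos (A i)) ` ?I \<noteq> {}" using nz by auto
  have "lambda_min_pos_all n A \<in> (\<lambda>i. lambda_min_pos (A i)) ` ?I"
    unfolding lambda_min_pos_all_def by (rule Min_in[OF _ I]) simp
  then show "0 < lambda_min_pos_all n A"
    using psd by (auto intro!: lambda_min_pos_pos)
  show spec: "lambda_min_pos_all n A \<le> \<mu> \<and> \<mu> \<le> L_max n A"
    if i: "i \<in> {1..n}" and \<mu>: "\<mu> \<in> eigvals (A i)" "\<mu> \<noteq> 0" for i \<mu>
  proof -
    have sym: "transpose (A i) = A i" using psd[OF i] by (simp add: sym_psd_def)
    obtain v where "v \<noteq> 0" "A i *v v = \<mu> *\<^sub>R v" using \<mu> by (auto simp: eigvals_def)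
    then have "A i \<noteq> 0" using \<mu> by auto
    then have "lambda_min_pos_all n A \<le> lambda_min_pos (A i)"
      unfolding lambda_min_pos_all_def using i by (intro Min_le) auto
    moreover have "lambda_max (A i) \<le> L_max n A"
      unfolding L_max_def using i by (intro Max_ge) auto
    ultimately show ?thesis
      using lambda_min_pos_le[OF sym \<mu>] lambda_max_ge[OF sym \<mu>(1)] by linarith
  qed
  obtain i where i: "i \<in> {1..n}" "A i \<noteq> 0" using nz by blast
  then show "lambda_min_pos_all n A \<le> L_max n A"
    using lambda_min_pos_mem[of "A i"] psd[OF i(1)] spec[OF i(1), of "lambda_min_pos (A i)"]
    by (auto simp: sym_psd_def)
qed

text \<open>A positive infimum is strictly below its multiple by \<open>c > 1\<close>, so some value
  falls in between.\<close>

lemma approximate_minimizer: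
  fixes T :: "'a \<Rightarrow> real"
  assumes "I \<noteq> {}" "0 < t" "\<And>x. x \<in> I \<Longrightarrow> t \<le> T x" "1 < c"
  obtains x where "x \<in> I" "\<And>y. y \<in> I \<Longrightarrow> T x \<le> c * T y"
proof -
  have bdd: "bdd_below (T ` I)" using assms(3) by (auto intro!: bdd_belowI2)
  have "t \<le> Inf (T ` I)" using assms(1,3) by (auto intro!: cINF_greatest)
  then have "Inf (T ` I) < c * Inf (T ` I)" using assms(2,4) by simp
  then obtain x where x: "x \<in> I" "T x < c * Inf (T ` I)"
    using cInf_lessD[of "T ` I"] assms(1) by auto
  have "T x \<le> c * T y" if "y \<in> I" for y
  proof -
    have "c * Inf (T ` I) \<le> c * T y"
      using cINF_lower[OF bdd that] assms(4) by simp
    with x(2) show ?thesis by linarith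
  qed
  with x(1) show thesis using that by blast
qed

section \<open>Running times of different stepsizes under fixed problem data\<close>

locale fedexprox =
  fixes n :: nat and A :: "nat \<Rightarrow> real^'d^'d" and b :: "nat \<Rightarrow> real^'d" and \<eta> \<tau> :: real
  assumes psd: "\<And>i. i \<in> {1..n} \<Longrightarrow> sym_psd (A i)"
    and nonzero: "\<exists>i\<in>{1..n}. A i \<noteq> 0"
    and eta: "0 \<le> \<eta>"
    and tau: "0 < \<tau>"
begin

abbreviation (input) L where "L \<equiv> L_max n A"
abbreviation (input) m where "m \<equiv> lambda_min_pos_all n A"
abbreviation (input) T where "T \<equiv> total_time n A b \<eta> \<tau>"
abbreviation (input) K where
  "K \<gamma> \<equiv> condition_number (avg_matrix n (\<lambda>i. envelope_matrix \<gamma> (A i)))"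

lemma spectrum_pos: "0 < m" "m \<le> L" "0 < L"
  using spectral_bounds[OF psd nonzero] by auto

lemma T_eq:
  assumes "0 \<le> \<gamma>"
  shows "T \<gamma> = (\<eta> + \<tau> * (\<gamma> * L + 1)) * K \<gamma>"
proof -
  have "env_hessian n A b \<gamma> = avg_matrix n (\<lambda>i. envelope_matrix \<gamma> (A i))"
    using psd assms by (rule env_hessian_eq)
  then show ?thesis by (simp only: total_time_def condition_number_def)
qed

lemma K_ge_1:
  assumes "0 \<le> \<gamma>"
  shows "1 \<le> K \<gamma>"
proof (rule condition_number_ge_1)
  show "sym_psd (avg_matrix n (\<lambda>i. envelope_matrix \<gamma> (A i)))"
    by (intro sym_psd_avg_matrix sym_psd_envelope_matrix psd assms)
  obtain i where "i \<in> {1..n}" "A i \<noteq> 0" using nonzero by blast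
  with psd assms show "avg_matrix n (\<lambda>i. envelope_matrix \<gamma> (A i)) \<noteq> 0"
    by (rule avg_envelope_matrix_nonzero)
qed

text \<open>This positive lower bound makes approximate minimization applicable and allows constants
  to be enlarged later.\<close>

lemma tau_le_T:
  assumes "0 \<le> \<gamma>"
  shows "\<tau> \<le> T \<gamma>"
proof -
  have "0 \<le> \<tau> * (\<gamma> * L)" using assms spectrum_pos tau by simp
  then have "\<tau> \<le> \<eta> + \<tau> * (\<gamma> * L + 1)" using eta by (simp add: distrib_left)
  then have "\<tau> * 1 \<le> (\<eta> + \<tau> * (\<gamma> * L + 1)) * K \<gamma>"
    using tau K_ge_1[OF assms] by (intro mult_mono) auto
  then show ?thesis by (simp add: T_eq assms)
qed

text \<open>Separates a comparison of running times into a factor \<open>c\<close> for the condition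
  numbers and an inequality between the costs per iteration.\<close>

lemma T_leI:
  assumes "0 \<le> \<gamma>" "0 \<le> \<delta>" "K \<gamma> \<le> c * K \<delta>"
    and "(\<eta> + \<tau> * (\<gamma> * L + 1)) * c \<le> C * (\<eta> + \<tau> * (\<delta> * L + 1))"
  shows "T \<gamma> \<le> C * T \<delta>"
proof -
  have "0 \<le> \<tau> * (\<gamma> * L + 1)" using assms(1) spectrum_pos tau by simp
  then have "T \<gamma> \<le> (\<eta> + \<tau> * (\<gamma> * L + 1)) * (c * K \<delta>)"
    unfolding T_eq[OF assms(1)] using assms(3) eta by (intro mult_left_mono) auto
  also have "\<dots> \<le> C * (\<eta> + \<tau> * (\<delta> * L + 1)) * K \<delta>"
    unfolding mult.assoc[symmetric] using assms(4) K_ge_1[OF assms(2)]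
    by (intro mult_right_mono) auto
  finally show ?thesis by (simp add: T_eq[OF assms(2)] mult.assoc)
qed

lemma K_bounds:
  assumes \<gamma>: "0 \<le> \<gamma>" "\<gamma> \<le> \<delta>"
    and c: "(1 + \<gamma> * m) / (1 + \<delta> * m) / ((1 + \<gamma> * L) / (1 + \<delta> * L)) \<le> c" (is "?r \<le> c")
  shows "K \<delta> \<le> c * K \<gamma>" "K \<gamma> \<le> c * K \<delta>"
proof -
  have "K \<delta> \<le> ?r * K \<gamma>" "K \<gamma> \<le> ?r * K \<delta>"
    using condition_number_envelope[OF psd nonzero \<gamma> _ _ spectral_bounds(3)[OF psd nonzero]] spectrum_pos
    by auto
  moreover have "?r * K \<gamma> \<le> c * K \<gamma>" "?r * K \<delta> \<le> c * K \<delta>"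
    using K_ge_1[of \<gamma>] K_ge_1[of \<delta>] \<gamma> by (intro mult_right_mono[OF c]; linarith)+
  ultimately show "K \<delta> \<le> c * K \<gamma>" "K \<gamma> \<le> c * K \<delta>"
    by linarith+
qed

text \<open>Estimates \<open>r(m)\<close> by 1, leaving \<open>1 / r(L)\<close>. This coarser factor
  suffices wherever the cost per iteration can absorb it.\<close>

lemma K_bounds_L:
  assumes \<gamma>: "0 \<le> \<gamma>" "\<gamma> \<le> \<delta>"
    and c: "(1 + \<delta> * L) / (1 + \<gamma> * L) \<le> c"
  shows "K \<delta> \<le> c * K \<gamma>" "K \<gamma> \<le> c * K \<delta>"
proof -
  have "0 \<le> \<delta> * m" "\<gamma> * m \<le> \<delta> * m"
    using \<gamma> spectrum_pos by (auto intro: mult_right_mono)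
  then have "(1 + \<gamma> * m) / (1 + \<delta> * m) \<le> 1" by simp
  moreover have "0 \<le> (1 + \<gamma> * L) / (1 + \<delta> * L)"
    using \<gamma> spectrum_pos by simp
  ultimately have "(1 + \<gamma> * m) / (1 + \<delta> * m) / ((1 + \<gamma> * L) / (1 + \<delta> * L))
      \<le> 1 / ((1 + \<gamma> * L) / (1 + \<delta> * L))"
    by (rule divide_right_mono)
  also have "\<dots> \<le> c" using c by simp
  finally show "K \<delta> \<le> c * K \<gamma>" "K \<gamma> \<le> c * K \<delta>"
    by (rule K_bounds[OF \<gamma>])+
qed

text \<open>The condition number at 0 is worse by at most \<open>1 + \<delta> * L\<close>.
  Computation at \<open>\<delta>\<close> already costs \<open>\<tau> * (1 + \<delta> * L)\<close>,
  and \<open>\<eta> + \<tau> \<le> 3 * \<tau>\<close>.\<close>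

lemma T_0_le:
  assumes "\<eta> \<le> 2 * \<tau>" "0 \<le> \<delta>"
  shows "T 0 \<le> 3 * T \<delta>"
proof -
  have K: "K 0 \<le> (1 + \<delta> * L) * K \<delta>"
    using assms(2) by (intro K_bounds_L(2)) auto
  have "\<eta> * (1 + \<delta> * L) \<le> 2 * \<tau> * (1 + \<delta> * L)"
    using assms spectrum_pos by (intro mult_right_mono) auto
  then show ?thesis
    using eta by (intro T_leI[OF order_refl assms(2) K]) (simp add: algebra_simps)
qed

text \<open>Below \<open>1 / L\<close> the condition number changes by at most a factor 2, and
  \<open>\<eta> + 2 * \<tau> \<le> 4 / 3 * (\<eta> + \<tau>)\<close> when
  \<open>2 * \<tau> \<le> \<eta>\<close>; the product is \<open>8 / 3\<close>.\<close>

lemma T_inverse_L_le: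
  assumes "2 * \<tau> \<le> \<eta>" "0 \<le> \<delta>" "\<delta> \<le> 1 / L"
  shows "T (1 / L) \<le> 8 / 3 * T \<delta>"
proof -
  have le: "(1 + 1 / L * L) / (1 + \<delta> * L) \<le> 2"
    using assms spectrum_pos by (simp add: divide_simps add_pos_nonneg)
  have "K (1 / L) \<le> 2 * K \<delta>"
    by (rule K_bounds_L(1)[OF assms(2,3) le])
  moreover have "0 \<le> \<tau> * (\<delta> * L)" using assms spectrum_pos tau by simp
  then have "(\<eta> + \<tau> * (1 / L * L + 1)) * 2 \<le> 8 / 3 * (\<eta> + \<tau> * (\<delta> * L + 1))"
    using assms(1) spectrum_pos unfolding distrib_left by simp
  ultimately show ?thesis
    using assms spectrum_pos by (intro T_leI) auto
qed

text \<open>At this stepsize computation and communication both cost \<open>\<eta>\<close>. Beyond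
  it the condition number improves at most as fast as the computation time grows, so the loss is the
  factor 2 from adding the two costs.\<close>

lemma T_le_beyond_eta:
  assumes "\<tau> \<le> \<eta>" "(\<eta> / \<tau> - 1) / L \<le> \<delta>"
  shows "T ((\<eta> / \<tau> - 1) / L) \<le> 2 * T \<delta>"
proof -
  let ?\<gamma> = "(\<eta> / \<tau> - 1) / L"
  have \<gamma>: "0 \<le> ?\<gamma>" using assms spectrum_pos tau by (simp add: divide_simps)
  with assms have \<delta>: "0 \<le> \<delta>" by linarith
  have \<gamma>L: "1 + ?\<gamma> * L = \<eta> / \<tau>" using spectrum_pos by simp
  have K: "K ?\<gamma> \<le> (1 + \<delta> * L) / (\<eta> / \<tau>) * K \<delta>"
    using \<gamma> assms(2) by (intro K_bounds_L(2)) (simp_all only: \<gamma>L order_refl)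
  have "\<tau> * (?\<gamma> * L + 1) = \<eta>" using \<gamma>L tau by (simp add: add.commute)
  then show ?thesis
    using assms tau by (intro T_leI[OF \<gamma> \<delta> K]) (simp add: field_simps)
qed

text \<open>Beyond \<open>1 / m\<close> the condition number can improve by at most a factor 2,
  while the cost per iteration only grows.\<close>

lemma T_le_beyond_inverse_m:
  assumes "1 / m \<le> \<delta>"
  shows "T (1 / m) \<le> 2 * T \<delta>"
proof -
  have \<gamma>: "0 \<le> 1 / m" using spectrum_pos by simp
  with assms have \<delta>: "0 \<le> \<delta>" by linarith
  have pos: "0 \<le> \<delta> * m" "0 \<le> \<delta> * L" "0 \<le> L / m" using \<delta> spectrum_pos by auto
  have "(1 + 1 / m * m) / (1 + \<delta> * m) / ((1 + 1 / m * L) / (1 + \<delta> * L))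
      = 2 * (1 + \<delta> * L) / ((1 + \<delta> * m) * (1 + L / m))"
    using spectrum_pos by simp
  also have "\<dots> \<le> 2"
  proof -
    \<comment> \<open>The cross term \<open>\<delta> * m * (L / m)\<close> equals
      \<open>\<delta> * L\<close>, so the product dominates the numerator.\<close>
    have "(1 + \<delta> * m) * (1 + L / m) = 1 + \<delta> * m + L / m + \<delta> * L"
      using spectrum_pos by (simp add: field_simps)
    then have "1 + \<delta> * L \<le> (1 + \<delta> * m) * (1 + L / m)" using pos by linarith
    moreover have "0 < (1 + \<delta> * m) * (1 + L / m)"
      using pos by (intro mult_pos_pos) linarith+
    ultimately show ?thesis by (simp add: pos_divide_le_eq)
  qed
  finally have "K (1 / m) \<le> 2 * K \<delta>"
    by (rule K_bounds(2)[OF \<gamma> assms])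
  moreover have "\<tau> * (1 / m * L + 1) \<le> \<tau> * (\<delta> * L + 1)"
    using tau spectrum_pos mult_right_mono[OF assms, of L] by simp
  ultimately show ?thesis
    using \<gamma> \<delta> eta by (intro T_leI) auto
qed

lemma T_0_minimizes:
  assumes "\<eta> \<le> 2 * \<tau>"
  shows "minimizes_up_to 4 T 0"
proof -
  have "T 0 \<le> 4 * T \<delta>" if "0 \<le> \<delta>" for \<delta>
    using T_0_le[OF assms that] tau_le_T[OF that] tau by linarith
  then show ?thesis by (simp add: minimizes_up_to_def)
qed

text \<open>Smaller stepsizes lose against the left endpoint and larger ones against the right
  endpoint, up to constants; an approximate minimizer on the interval is compared with both
  endpoints.\<close>

lemma exists_minimizer:
  assumes "2 * \<tau> \<le> \<eta>"
  shows "\<exists>\<gamma> \<in> {1 / L .. min ((\<eta> / \<tau> - 1) / L) (1 / m)}. minimizes_up_to 4 T \<gamma>"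
proof -
  let ?u = "min ((\<eta> / \<tau> - 1) / L) (1 / m)"
  have "1 \<le> \<eta> / \<tau> - 1" using assms tau by (simp add: divide_simps)
  then have "1 / L \<le> (\<eta> / \<tau> - 1) / L" using spectrum_pos by (intro divide_right_mono) auto
  moreover have "1 / L \<le> 1 / m" using spectrum_pos by (intro divide_left_mono) auto
  ultimately have u: "1 / L \<le> ?u" by simp
  have pos: "0 < 1 / L" using spectrum_pos by simp
  text \<open>An approximate minimizer spares the proof that \<open>T\<close> is continuous; the factors
    \<open>4/3 * 8/3\<close> and \<open>4/3 * 2\<close> still stay below \<open>4\<close>.\<close>
  obtain \<gamma> where \<gamma>: "\<gamma> \<in> {1 / L .. ?u}" "\<And>\<delta>. \<delta> \<in> {1 / L .. ?u} \<Longrightarrow> T \<gamma> \<le> 4 / 3 * T \<delta>"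
  proof (rule approximate_minimizer[of "{1 / L .. ?u}" \<tau> T "4 / 3"])
    fix \<delta> assume "\<delta> \<in> {1 / L .. ?u}"
    then have "1 / L \<le> \<delta>" by simp
    with pos show "\<tau> \<le> T \<delta>" by (intro tau_le_T) linarith
  qed (use u tau in auto)
  have "T \<gamma> \<le> 4 * T \<delta>" if \<delta>: "0 \<le> \<delta>" for \<delta>
  proof -
    have T\<delta>: "0 < T \<delta>" using tau_le_T[OF \<delta>] tau by linarith
    consider "\<delta> < 1 / L" | "\<delta> \<in> {1 / L .. ?u}" | "?u < \<delta>" by force
    then show ?thesis
    proof cases
      case 1
      then have "T (1 / L) \<le> 8 / 3 * T \<delta>" using assms \<delta> by (intro T_inverse_L_le) auto
      moreover have "T \<gamma> \<le> 4 / 3 * T (1 / L)" using u by (intro \<gamma>(2)) auto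
      ultimately show ?thesis using T\<delta> by linarith
    next
      case 2
      then show ?thesis using \<gamma>(2)[of \<delta>] T\<delta> by linarith
    next
      case 3
      \<comment> \<open>Whichever bound is active at the right endpoint decides which of the two
        comparisons applies.\<close>
      have "T ?u \<le> 2 * T \<delta>"
      proof (cases "(\<eta> / \<tau> - 1) / L \<le> 1 / m")
        case True
        then show ?thesis using 3 assms tau T_le_beyond_eta[of \<delta>] by (simp add: min_def)
      next
        case False
        then show ?thesis using 3 T_le_beyond_inverse_m[of \<delta>] by (simp add: min_def)
      qed
      moreover have "T \<gamma> \<le> 4 / 3 * T ?u" using u by (intro \<gamma>(2)) auto
      ultimately show ?thesis using T\<delta> by linarith
    qed
  qed
  moreover have "1 / L \<le> \<gamma>" using \<gamma>(1) by simp
  with pos have "0 \<le> \<gamma>" by linarith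
  ultimately show ?thesis using \<gamma>(1) unfolding minimizes_up_to_def by blast
qed

end

theorem theorem4p3:
  fixes n :: nat
    and A :: "nat \<Rightarrow> real^'d^'d"
    and b :: "nat \<Rightarrow> real^'d"
    and \<eta> \<tau> :: real
  assumes n: "1 \<le> n"
    and psd: "\<And>i. i \<in> {1..n} \<Longrightarrow> sym_psd (A i)"
    and nonzero: "\<exists>i\<in>{1..n}. A i \<noteq> 0"
    and interpolation: "\<exists>xs. \<forall>i\<in>{1..n}. GDERIV (quad (A i) (b i)) xs :> 0"
    and eta: "0 \<le> \<eta>"
    and tau: "0 < \<tau>"
  shows
    "(\<eta> / \<tau> \<ge> 2 \<longrightarrow>
       (\<exists>\<gamma> \<in> {1 / L_max n A ..
               min ((\<eta> / \<tau> - 1) / L_max n A) (1 / lambda_min_pos_all n A)}.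
          minimizes_up_to 4 (total_time n A b \<eta> \<tau>) \<gamma> \<and>
          total_time n A b \<eta> \<tau> \<gamma> \<le> 4 * gd_time n A \<eta> \<tau>)) \<and>
     (\<eta> / \<tau> < 2 \<longrightarrow>
       (\<exists>\<gamma> \<in> {0 ..
               max 0 (min ((\<eta> / \<tau> - 1) / L_max n A) (1 / lambda_min_pos_all n A))}.
          minimizes_up_to 4 (total_time n A b \<eta> \<tau>) \<gamma> \<and>
          total_time n A b \<eta> \<tau> \<gamma> \<le> 4 * gd_time n A \<eta> \<tau>))"
proof -
  interpret fedexprox n A b \<eta> \<tau>
    using psd nonzero eta tau by unfold_locales
  \<comment> \<open>Gradient descent is the competitor \<open>\<gamma>' = 0\<close>, so the bound
    holds with the same constant 4.\<close>
  have gd: "total_time n A b \<eta> \<tau> \<gamma> \<le> 4 * gd_time n A \<eta> \<tau>"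
    if "minimizes_up_to 4 (total_time n A b \<eta> \<tau>) \<gamma>" for \<gamma>
    using that by (metis minimizes_up_to_def order_refl total_time_zero)
  show ?thesis
  proof (intro conjI impI)
    assume "\<eta> / \<tau> \<ge> 2"
    then have "2 * \<tau> \<le> \<eta>" using tau by (simp add: divide_simps)
    then show "\<exists>\<gamma> \<in> {1 / L_max n A ..
        min ((\<eta> / \<tau> - 1) / L_max n A) (1 / lambda_min_pos_all n A)}.
          minimizes_up_to 4 (total_time n A b \<eta> \<tau>) \<gamma> \<and>
          total_time n A b \<eta> \<tau> \<gamma> \<le> 4 * gd_time n A \<eta> \<tau>"
      using exists_minimizer gd by blast
  next
    assume "\<eta> / \<tau> < 2"
    then have "\<eta> \<le> 2 * \<tau>" using tau by (simp add: divide_simps)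
    then show "\<exists>\<gamma> \<in> {0 ..
        max 0 (min ((\<eta> / \<tau> - 1) / L_max n A) (1 / lambda_min_pos_all n A))}.
          minimizes_up_to 4 (total_time n A b \<eta> \<tau>) \<gamma> \<and>
          total_time n A b \<eta> \<tau> \<gamma> \<le> 4 * gd_time n A \<eta> \<tau>"
      \<comment> \<open>The witness 0 lies in the interval because its upper end is a maximum with
        0.\<close>
      using T_0_minimizes gd by (intro bexI[of _ 0]) auto
  qed
qed

end
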